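(* Let $A$ be a finite alphabet with an involution $\theta$ (possibly with fixed points) and let $T$ be a linear involution relative to $A$ (and $\theta$) without connections. Then the natural coding $\mathcal{L}(T)$ of $T$ is a specular set on $A$ relative to $\theta$.
   Context: Specular sets. A set $S$ of words on $A$ is factorial if it contains $A$ and all the factors of its elements; $\varepsilon$ is the empty word. For $w\in S$ let $L(w)=\{a\in A\mid aw\in S\}$, $R(w)=\{a\in A\mid wa\in S\}$, $B(w)=\{(a,b)\in A\times A\mid awb\in S\}$. A factorial set $S$ is biextendable if $B(w)\neq\emptyset$ for all $w\in S$. The extension graph $\mathcal{E}(w)$ is the undirected graph whose vertex set is the disjoint union of $L(w)$ and $R(w)$ and whose edges are the pairs in $B(w)$. A biextendable set is a tree set of characteristic $2$ if $\mathcal{E}(w)$ is a tree for every nonempty $w\in S$ and $\mathcal{E}(\varepsilon)$ is a disjoint union of two trees. Let $G_\theta$ be the group generated by $A$ with relations $a\theta(a)=1$, so $a^{-1}=\theta(a)$. A word is reduced if it has no factor $a\theta(a)$, $a\in A$; the inverse of a reduced word $a_1\cdots a_n$ is $\theta(a_n)\cdots\theta(a_1)$. A specular set relative to $\theta$ is a biextendable set of reduced words, closed under taking inverses, which is a tree set of characteristic $2$. Linear involutions. Let $k=\mathrm{Card}(A)$, let $I$ be an open interval of the real line and $\hat I=I\times\{0,1\}$, with components $I\times\{0\}$ and $I\times\{1\}$, each regarded as an open interval. Let $\ell+m=k$ and let $\pi:\{1,\dots,k\}\to A$ be a bijection (generalized permutation of type $(\ell,m)$). Let $\lambda\in\mathbb{R}^A$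 be a vector with positive entries such that $\lambda_{\pi(1)}+\dots+\lambda_{\pi(\ell)}=\lambda_{\pi(\ell+1)}+\dots+\lambda_{\pi(k)}$ (this common value being the length of $I$) and $\lambda_a=\lambda_{a^{-1}}$ for all $a\in A$. Partition $I\times\{0\}$, minus $\ell-1$ points, into consecutive (left to right) open intervals $I_{\pi(1)},\dots,I_{\pi(\ell)}$ of lengths $\lambda_{\pi(1)},\dots,\lambda_{\pi(\ell)}$, and $I\times\{1\}$, minus $m-1$ points, into consecutive open intervals $I_{\pi(\ell+1)},\dots,I_{\pi(k)}$ of lengths $\lambda_{\pi(\ell+1)},\dots,\lambda_{\pi(k)}$. Let $\Sigma$ be the set of the $k-2$ division points separating the intervals $I_a$. A linear involution relative to these data is the map $T=\sigma_2\circ\sigma_1$ on $\hat I\setminus\Sigma$, where $\sigma_1$ is an involution of $\hat I\setminus\Sigma$ whose restriction to each $I_a$ is either a translation or a symmetry (orientation-reversing isometry) from $I_a$ onto $I_{a^{-1}}$, and $\sigma_2(x,\delta)=(x,1-\delta)$. The singularities of $T$ are the points of $\Sigma$, and those of $T^{-1}=\sigma_1\circ\sigma_2$ are the points of $\sigma_2(\Sigma)$. A connection of $T$ is a triple $(x,y,n)$ with $x$ a singularity of $T^{-1}$, $y$ a singularity of $T$, $n\ge0$ and $T^nx=y$. Natural coding. Let $O=\bigcup_{n\ge0}T^{-n}(\Sigma)$ and $\hat O=O\cup\sigma_2(O)$. If $T$ has no connections, $T$ is a bijection of $\hat I\setminus\hat O$ onto itself. For $z\in\hat I\setminus\hat O$,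 the infinite natural coding of $T$ relative to $z$ is the infinite word $a_0a_1\cdots$ with $a_n=a$ if $T^n(z)\in I_a$. The natural coding $\mathcal{L}(T)$ is the set of all (finite) factors of the infinite natural codings of $T$ relative to points $z\in\hat I\setminus\hat O$. *)

theory Defs
  imports Complex_Main "HOL-Library.Sublist"
begin

section \<open>Undirected graphs and trees\<close>

text \<open>
  A simple undirected graph is given by its vertex set \<open>V\<close> and its set \<open>E\<close> of two-element edges.
  Trees are nonempty, connected and have no cycle; a cycle has at least three vertices, all distinct.
\<close>

definition simple_graph :: "'v set \<Rightarrow> 'v set set \<Rightarrow> bool" where
  "simple_graph V E \<longleftrightarrow> (\<forall>e\<in>E. \<exists>x\<in>V. \<exists>y\<in>V. x \<noteq> y \<and> e = {x, y})"

definition connected_graph :: "'v set \<Rightarrow> 'v set set \<Rightarrow> bool" where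
  "connected_graph V E \<longleftrightarrow>
    V \<noteq> {} \<and> (\<forall>x\<in>V. \<forall>y\<in>V. (x, y) \<in> {(p, q). p \<in> V \<and> q \<in> V \<and> {p, q} \<in> E}\<^sup>*)"

definition graph_cycle :: "'v set \<Rightarrow> 'v set set \<Rightarrow> 'v list \<Rightarrow> bool" where
  "graph_cycle V E vs \<longleftrightarrow>
    3 \<le> length vs \<and> distinct vs \<and> set vs \<subseteq> V \<and>
    (\<forall>i < length vs. {vs ! i, vs ! (Suc i mod length vs)} \<in> E)"

definition tree_graph :: "'v set \<Rightarrow> 'v set set \<Rightarrow> bool" where
  "tree_graph V E \<longleftrightarrow>
    simple_graph V E \<and> connected_graph V E \<and> \<not> (\<exists>vs. graph_cycle V E vs)"

definition disjoint_union_of_two_trees :: "'v set \<Rightarrow> 'v set set \<Rightarrow> bool" where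
  "disjoint_union_of_two_trees V E \<longleftrightarrow>
    (\<exists>V1 E1 V2 E2. tree_graph V1 E1 \<and> tree_graph V2 E2 \<and>
       V1 \<inter> V2 = {} \<and> V = V1 \<union> V2 \<and> E = E1 \<union> E2)"


section \<open>Specular sets\<close>

definition factorial_set :: "'a set \<Rightarrow> 'a list set \<Rightarrow> bool" where
  "factorial_set A S \<longleftrightarrow>
    S \<subseteq> lists A \<and> (\<forall>a\<in>A. [a] \<in> S) \<and> (\<forall>w\<in>S. \<forall>u. sublist u w \<longrightarrow> u \<in> S)"

definition left_ext :: "'a set \<Rightarrow> 'a list set \<Rightarrow> 'a list \<Rightarrow> 'a set" where
  "left_ext A S w = {a \<in> A. a # w \<in> S}"

definition right_ext :: "'a set \<Rightarrow> 'a list set \<Rightarrow> 'a list \<Rightarrow> 'a set" where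
  "right_ext A S w = {a \<in> A. w @ [a] \<in> S}"

definition bi_ext :: "'a set \<Rightarrow> 'a list set \<Rightarrow> 'a list \<Rightarrow> ('a \<times> 'a) set" where
  "bi_ext A S w = {(a, b) \<in> A \<times> A. a # w @ [b] \<in> S}"

definition biextendable :: "'a set \<Rightarrow> 'a list set \<Rightarrow> bool" where
  "biextendable A S \<longleftrightarrow> factorial_set A S \<and> (\<forall>w\<in>S. bi_ext A S w \<noteq> {})"

definition ext_verts :: "'a set \<Rightarrow> 'a list set \<Rightarrow> 'a list \<Rightarrow> ('a + 'a) set" where
  "ext_verts A S w = left_ext A S w <+> right_ext A S w"

definition ext_edges :: "'a set \<Rightarrow> 'a list set \<Rightarrow> 'a list \<Rightarrow> ('a + 'a) set set" where
  "ext_edges A S w = {{Inl a, Inr b} | a b. (a, b) \<in> bi_ext A S w}"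

definition tree_set_char_two :: "'a set \<Rightarrow> 'a list set \<Rightarrow> bool" where
  "tree_set_char_two A S \<longleftrightarrow>
    biextendable A S \<and>
    (\<forall>w\<in>S. w \<noteq> [] \<longrightarrow> tree_graph (ext_verts A S w) (ext_edges A S w)) \<and>
    disjoint_union_of_two_trees (ext_verts A S []) (ext_edges A S [])"

definition reduced_word :: "'a set \<Rightarrow> ('a \<Rightarrow> 'a) \<Rightarrow> 'a list \<Rightarrow> bool" where
  "reduced_word A \<theta> w \<longleftrightarrow> \<not> (\<exists>a\<in>A. sublist [a, \<theta> a] w)"

definition inverse_word :: "('a \<Rightarrow> 'a) \<Rightarrow> 'a list \<Rightarrow> 'a list" where
  "inverse_word \<theta> w = map \<theta> (rev w)"

definition specular_set :: "'a set \<Rightarrow> ('a \<Rightarrow> 'a) \<Rightarrow> 'a list set \<Rightarrow> bool" where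
  "specular_set A \<theta> S \<longleftrightarrow>
    biextendable A S \<and>
    (\<forall>w\<in>S. reduced_word A \<theta> w) \<and>
    (\<forall>w\<in>S. inverse_word \<theta> w \<in> S) \<and>
    tree_set_char_two A S"


section \<open>Linear involutions\<close>

locale involutive_alphabet =
  fixes A :: "'a set" and \<theta> :: "'a \<Rightarrow> 'a"
  assumes finite_alphabet: "finite A"
    and theta_closed: "a \<in> A \<Longrightarrow> \<theta> a \<in> A"
    and theta_involution: "a \<in> A \<Longrightarrow> \<theta> (\<theta> a) = a"

text \<open>
  The interval \<open>I\<close> is \<open>{lo<..<hi}\<close> and the two components of \<open>I \<times> {0,1}\<close> are labelled by the
  natural numbers \<open>0\<close> and \<open>1\<close>. The generalized permutation of type \<open>(l, m)\<close> is \<open>\<pi>\<close>, and \<open>len a\<close>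
  is the length of the interval indexed by \<open>a\<close>; bijectivity of \<open>\<pi>\<close> forces \<open>l + m = card A\<close>, and the
  length conditions with \<open>lo < hi\<close> force \<open>l, m \<ge> 1\<close>.
\<close>

locale linear_involution_data = involutive_alphabet A \<theta>
  for A :: "'a set" and \<theta> :: "'a \<Rightarrow> 'a" +
  fixes lo hi :: real
    and l m :: nat
    and \<pi> :: "nat \<Rightarrow> 'a"
    and len :: "'a \<Rightarrow> real"
  assumes interval_nonempty: "lo < hi"
    and perm: "bij_betw \<pi> {1..l + m} A"
    and len_pos: "a \<in> A \<Longrightarrow> 0 < len a"
    and len_theta: "a \<in> A \<Longrightarrow> len (\<theta> a) = len a"
    and len_top: "(\<Sum>i = 1..l. len (\<pi> i)) = hi - lo"
    and len_bottom: "(\<Sum>i = l + 1..l + m. len (\<pi> i)) = hi - lo"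
begin

definition I_hat :: "(real \<times> nat) set" where
  "I_hat = {lo<..<hi} \<times> {0, 1}"

text \<open>Right endpoint of the \<open>i\<close>-th interval of component 0, respectively of the \<open>j\<close>-th one of component 1.\<close>

definition top_end :: "nat \<Rightarrow> real" where
  "top_end i = lo + (\<Sum>n = 1..i. len (\<pi> n))"

definition bottom_end :: "nat \<Rightarrow> real" where
  "bottom_end j = lo + (\<Sum>n = l + 1..l + j. len (\<pi> n))"

text \<open>The interval indexed by the letter \<open>\<pi> i\<close>, for \<open>1 \<le> i \<le> l + m\<close>.\<close>

definition indexed_interval :: "nat \<Rightarrow> (real \<times> nat) set" where
  "indexed_interval i =
    (if i \<le> l then {top_end (i - 1)<..<top_end i} \<times> {0}
     else {bottom_end (i - l - 1)<..<bottom_end (i - l)} \<times> {1})"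

definition letter_interval :: "'a \<Rightarrow> (real \<times> nat) set" where
  "letter_interval a = indexed_interval (inv_into {1..l + m} \<pi> a)"

definition division_points :: "(real \<times> nat) set" where
  "division_points =
    {(top_end i, 0) | i. 1 \<le> i \<and> i < l} \<union> {(bottom_end j, 1) | j. 1 \<le> j \<and> j < m}"

end

definition flip_component :: "real \<times> nat \<Rightarrow> real \<times> nat" where
  "flip_component = (\<lambda>(x, \<delta>). (x, 1 - \<delta>))"

text \<open>
  The first involution is the parameter \<open>\<sigma>1\<close>; only its values off the division points matter.
  Translations and symmetries may also change the component.
\<close>

locale linear_involution = linear_involution_data A \<theta> lo hi l m \<pi> len
  for A :: "'a set" and \<theta> :: "'a \<Rightarrow> 'a" and lo hi :: real and l m :: nat
    and \<pi> :: "nat \<Rightarrow> 'a" and len :: "'a \<Rightarrow> real" +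
  fixes \<sigma>1 :: "real \<times> nat \<Rightarrow> real \<times> nat"
  assumes sigma1_closed: "z \<in> I_hat - division_points \<Longrightarrow> \<sigma>1 z \<in> I_hat - division_points"
    and sigma1_involution: "z \<in> I_hat - division_points \<Longrightarrow> \<sigma>1 (\<sigma>1 z) = z"
    and sigma1_onto: "a \<in> A \<Longrightarrow> \<sigma>1 ` letter_interval a = letter_interval (\<theta> a)"
    and sigma1_isometry:
      "a \<in> A \<Longrightarrow> \<exists>\<alpha> \<gamma>.
         (\<forall>(x, \<delta>) \<in> letter_interval a. \<sigma>1 (x, \<delta>) = (x + \<alpha>, \<gamma>)) \<or>
         (\<forall>(x, \<delta>) \<in> letter_interval a. \<sigma>1 (x, \<delta>) = (- x + \<alpha>, \<gamma>))"
begin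

text \<open>\<open>T\<close> is a partial map: it is undefined at the division points.\<close>

definition T :: "real \<times> nat \<Rightarrow> (real \<times> nat) option" where
  "T z = (if z \<in> I_hat - division_points then Some (flip_component (\<sigma>1 z)) else None)"

primrec T_pow :: "nat \<Rightarrow> real \<times> nat \<Rightarrow> (real \<times> nat) option" where
  "T_pow 0 z = Some z"
| "T_pow (Suc n) z = Option.bind (T_pow n z) T"

definition connection :: "real \<times> nat \<Rightarrow> real \<times> nat \<Rightarrow> nat \<Rightarrow> bool" where
  "connection x y n \<longleftrightarrow>
    x \<in> flip_component ` division_points \<and> y \<in> division_points \<and> T_pow n x = Some y"

definition orbit_set :: "(real \<times> nat) set" where
  "orbit_set = {z \<in> I_hat. \<exists>n. \<exists>y\<in>division_points. T_pow n z = Some y}"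

definition orbit_set_hat :: "(real \<times> nat) set" where
  "orbit_set_hat = orbit_set \<union> flip_component ` orbit_set"

definition infinite_coding :: "real \<times> nat \<Rightarrow> (nat \<Rightarrow> 'a) \<Rightarrow> bool" where
  "infinite_coding z w \<longleftrightarrow>
    (\<forall>n. w n \<in> A \<and> (\<exists>p. T_pow n z = Some p \<and> p \<in> letter_interval (w n)))"

definition natural_coding :: "'a list set" where
  "natural_coding =
    {map w [i..<j] | w i j. \<exists>z \<in> I_hat - orbit_set_hat. infinite_coding z w}"

end

end

theory Submission
  imports Defs "HOL-Analysis.Continuum_Not_Denumerable"
begin

text \<open>
  Write \<open>\<tau>\<close> for the map \<open>T\<close> made total. The points whose orbit starts with a nonempty word \<open>w\<close> form
  an open interval (\<open>cyl w\<close>) on which \<open>\<tau>\<close> iterated \<open>length w\<close> times is an isometry; as the excluded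
  orbits are countable, \<open>w\<close> is in the natural coding iff this interval is nonempty. Left extensions of
  \<open>w\<close> cut it at flipped division points, right extensions at the pullbacks of the division points.
  Since there are no connections, the two subdivisions have no common cut point, and the overlap
  graph of two such subdivisions of an interval is a tree: it is connected because the interval is,
  and acyclic by an extremal argument. The empty word gives one tree for each component.
\<close>

section \<open>Overlap graphs of intervals\<close>

text \<open>The sets of the vertices reachable from \<open>x\<close> and those of the remaining
  vertices have disjoint open unions, since an overlap would give an edge. These unions cover
  \<open>J\<close>, so connectedness empties the second one.\<close>

lemma connected_overlap_graph:
  fixes f :: "'v \<Rightarrow> 'b::topological_space set"
  assumes conn: "connected J" and ne: "J \<noteq> {}"
    and opn: "\<And>v. v \<in> V \<Longrightarrow> open (f v) \<and> f v \<noteq> {}"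
    and cover: "(\<Union>v\<in>V. f v) = J"
    and edge: "\<And>x y. x \<in> V \<Longrightarrow> y \<in> V \<Longrightarrow> x \<noteq> y \<Longrightarrow> f x \<inter> f y \<noteq> {} \<Longrightarrow> {x, y} \<in> E"
  shows "connected_graph V E"
  unfolding connected_graph_def
proof (intro conjI ballI)
  show "V \<noteq> {}" using ne cover by auto
  fix x y assume x: "x \<in> V" and y: "y \<in> V"
  define R where "R = {(p, q). p \<in> V \<and> q \<in> V \<and> {p, q} \<in> E}"
  define C where "C = {v \<in> V. (x, v) \<in> R\<^sup>*}"
  define U where "U = (\<Union>v\<in>C. f v)"
  define W where "W = (\<Union>v\<in>V - C. f v)"
  have "U \<inter> W = {}"
  proof (rule ccontr)
    assume "U \<inter> W \<noteq> {}"
    then obtain u w where u: "u \<in> C" and w: "w \<in> V" "w \<notin> C" and "f u \<inter> f w \<noteq> {}"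
      unfolding U_def W_def by blast
    then have "(u, w) \<in> R" using edge[of u w] by (auto simp: R_def C_def)
    then show False using u w by (auto simp: C_def intro: rtrancl_into_rtrancl)
  qed
  moreover have "open U" "open W" using opn by (auto simp: U_def W_def C_def)
  moreover have "J = U \<union> W" using cover by (auto simp: U_def W_def C_def)
  moreover have "U \<noteq> {}" using x opn by (auto simp: U_def C_def)
  ultimately have "W = {}"
    using connectedD[OF conn, of U W] by blast
  then have "y \<in> C" using y opn by (auto simp: W_def)
  then show "(x, y) \<in> {(p, q). p \<in> V \<and> q \<in> V \<and> {p, q} \<in> E}\<^sup>*"
    by (simp add: C_def R_def)
qed

text \<open>
  In a cycle, look at the interval with the least right endpoint: both of its neighbours contain
  all points just to the left of that endpoint, so they meet.
\<close>

lemma overlap_graph_acyclic: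
  fixes f :: "'v \<Rightarrow> real set"
  assumes ivl: "\<And>v. v \<in> V \<Longrightarrow> \<exists>c d. f v = {c<..<d}"
    and disj: "\<And>x y. x \<in> V \<Longrightarrow> y \<in> V \<Longrightarrow> x \<noteq> y \<Longrightarrow> k x = (k y :: bool) \<Longrightarrow> f x \<inter> f y = {}"
    and edge: "\<And>x y. {x, y} \<in> E \<Longrightarrow> k x \<noteq> k y \<and> f x \<inter> f y \<noteq> {}"
  shows "\<not> graph_cycle V E vs"
proof
  assume cyc: "graph_cycle V E vs"
  obtain lf rt where f: "\<And>v. v \<in> V \<Longrightarrow> f v = {lf v<..<rt v}" using ivl by metis
  define n where "n = length vs"
  have n: "3 \<le> n" and dist: "distinct vs" and V: "\<And>i. i < n \<Longrightarrow> vs ! i \<in> V"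
    and E: "\<And>i. i < n \<Longrightarrow> {vs ! i, vs ! (Suc i mod n)} \<in> E"
    using cyc by (auto simp: graph_cycle_def n_def)
  obtain i where i: "i < n" and least: "\<And>j. j < n \<Longrightarrow> rt (vs ! i) \<le> rt (vs ! j)"
    using arg_min_least[of "{..<n}" _ "\<lambda>j. rt (vs ! j)"]
      arg_min_if_finite(1)[of "{..<n}" "\<lambda>j. rt (vs ! j)"] n
    by fastforce
  \<comment> \<open>\<open>j\<close> and \<open>h\<close> are the cyclic successor and predecessor
    of \<open>i\<close>; they differ because a cycle has at least three vertices.\<close>
  define j where "j = Suc i mod n"
  define h where "h = (if i = 0 then n - 1 else i - 1)"
  have j: "j < n" and h: "h < n" "Suc h mod n = i" and hj: "h \<noteq> j"
    using n i by (auto simp: j_def h_def mod_Suc)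
  have "{vs ! i, vs ! j} \<in> E" "{vs ! h, vs ! i} \<in> E" using E[OF i] E[OF h(1)] h j_def by auto
  then have e: "k (vs ! i) \<noteq> k (vs ! j)" "f (vs ! i) \<inter> f (vs ! j) \<noteq> {}"
    "k (vs ! h) \<noteq> k (vs ! i)" "f (vs ! h) \<inter> f (vs ! i) \<noteq> {}"
    using edge by auto
  then obtain p q where p: "p \<in> f (vs ! i)" "p \<in> f (vs ! j)" and q: "q \<in> f (vs ! i)" "q \<in> f (vs ! h)"
    by blast
  \<comment> \<open>Both \<open>p\<close> and \<open>q\<close> lie below the least right endpoint,
    and their maximum exceeds the left endpoints of both neighbours.\<close>
  have "max p q \<in> f (vs ! j) \<inter> f (vs ! h)"
    using p q f[OF V[OF i]] f[OF V[OF j]] f[OF V[OF h(1)]] least[OF j] least[OF h(1)] by auto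
  moreover have "vs ! j \<noteq> vs ! h"
    using dist hj j h by (simp add: n_def nth_eq_iff_index_eq)
  \<comment> \<open>As \<open>k\<close> takes only two values, both neighbours of
    \<open>vs ! i\<close> lie on the side opposite to it, where distinct intervals are
    disjoint.\<close>
  ultimately show False using disj[OF V[OF j] V[OF h(1)]] e by auto
qed

text \<open>Each family may omit its own cut points, so the cover condition concerns both families
  jointly: a cut point of one has to lie in an interval of the other. The absence of connections
  will supply this.\<close>

lemma overlap_tree_graph:
  fixes P :: "'a \<Rightarrow> real set" and Q :: "'b \<Rightarrow> real set"
  assumes J: "c < d"
    and P: "\<And>a. a \<in> F \<Longrightarrow> P a \<noteq> {} \<and> (\<exists>u v. P a = {u<..<v})"
    and Q: "\<And>b. b \<in> G \<Longrightarrow> Q b \<noteq> {} \<and> (\<exists>u v. Q b = {u<..<v})"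
    and disjP: "\<And>a a'. a \<in> F \<Longrightarrow> a' \<in> F \<Longrightarrow> a \<noteq> a' \<Longrightarrow> P a \<inter> P a' = {}"
    and disjQ: "\<And>b b'. b \<in> G \<Longrightarrow> b' \<in> G \<Longrightarrow> b \<noteq> b' \<Longrightarrow> Q b \<inter> Q b' = {}"
    and cover: "(\<Union>a\<in>F. P a) \<union> (\<Union>b\<in>G. Q b) = {c<..<d}"
  shows "tree_graph (F <+> G) {{Inl a, Inr b} | a b. a \<in> F \<and> b \<in> G \<and> P a \<inter> Q b \<noteq> {}}"
    (is "tree_graph ?V ?E")
proof -
  \<comment> \<open>The two families become one family on the vertices, with \<open>k\<close>
    recording the side; edges are then the overlaps between opposite sides.\<close>
  define f where "f = case_sum P Q"
  define k :: "'a + 'b \<Rightarrow> bool" where "k = isl"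
  have f: "f v \<noteq> {} \<and> (\<exists>u w. f v = {u<..<w})" if "v \<in> ?V" for v
    using that P Q by (auto simp: f_def)
  have disj: "f x \<inter> f y = {}" if "x \<in> ?V" "y \<in> ?V" "x \<noteq> y" "k x = k y" for x y
    using that(1,2)
    by (elim PlusE; use that(3,4) in \<open>simp add: f_def k_def disjP disjQ\<close>)
  have edge: "{x, y} \<in> ?E \<longleftrightarrow> x \<in> ?V \<and> y \<in> ?V \<and> k x \<noteq> k y \<and> f x \<inter> f y \<noteq> {}" for x y
    by (cases x; cases y) (auto simp: f_def k_def doubleton_eq_iff)
  have "simple_graph ?V ?E" unfolding simple_graph_def
  proof
    fix e assume "e \<in> ?E"
    then obtain a b where "e = {Inl a, Inr b}" "a \<in> F" "b \<in> G" by blast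
    then show "\<exists>x\<in>?V. \<exists>y\<in>?V. x \<noteq> y \<and> e = {x, y}"
      by (intro bexI[of _ "Inl a"] bexI[of _ "Inr b"]) auto
  qed
  moreover have "connected_graph ?V ?E"
  proof (rule connected_overlap_graph[where f = f and J = "{c<..<d}"])
    show "(\<Union>v\<in>?V. f v) = {c<..<d}" unfolding cover[symmetric] by (auto simp: f_def)
    show "open (f v) \<and> f v \<noteq> {}" if "v \<in> ?V" for v using f[OF that] by auto
    show "{x, y} \<in> ?E" if "x \<in> ?V" "y \<in> ?V" "x \<noteq> y" "f x \<inter> f y \<noteq> {}" for x y
      using that disj[OF that(1-3)] unfolding edge by (cases "k x = k y") simp_all
  qed (use J in auto)
  moreover have "\<not> (\<exists>vs. graph_cycle ?V ?E vs)"
  proof (intro notI, elim exE)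
    fix vs assume "graph_cycle ?V ?E vs"
    moreover have "\<not> graph_cycle ?V ?E vs"
    proof (rule overlap_graph_acyclic[where f = f and k = k])
      show "\<exists>c d. f v = {c<..<d}" if "v \<in> ?V" for v using f[OF that] by blast
      show "k x \<noteq> k y \<and> f x \<inter> f y \<noteq> {}" if "{x, y} \<in> ?E" for x y
        using edge[THEN iffD1, OF that] by simp
    qed (rule disj)
    ultimately show False by contradiction
  qed
  ultimately show ?thesis by (simp add: tree_graph_def)
qed

section \<open>The partition into letter intervals\<close>

lemma subdivision_cover:
  fixes e :: "nat \<Rightarrow> real"
  assumes "e 0 < x" "x < e n" "\<And>i. 1 \<le> i \<Longrightarrow> i < n \<Longrightarrow> x \<noteq> e i"
  shows "\<exists>i\<in>{1..n}. e (i - 1) < x \<and> x < e i"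
  using assms
proof (induction n)
  case (Suc n)
  show ?case
  proof (cases "x < e n")
    case True
    then have "\<exists>i\<in>{1..n}. e (i - 1) < x \<and> x < e i"
      using Suc.IH[OF Suc.prems(1)] Suc.prems(3) by simp
    then show ?thesis by (meson atLeastAtMost_iff le_SucI)
  next
    case False
    \<comment> \<open>The avoidance hypothesis starts at index 1; for \<open>n = 0\<close> the bound
      \<open>e 0 < x\<close> takes its place.\<close>
    moreover have "x \<noteq> e n" using Suc.prems(1) Suc.prems(3)[of n] by (cases "n = 0") auto
    ultimately show ?thesis using Suc.prems(2) by (intro bexI[of _ "Suc n"]) auto
  qed
qed auto

lemma subdivision_unique:
  fixes e :: "nat \<Rightarrow> real"
  assumes mono: "\<And>i j. i \<le> j \<Longrightarrow> j \<le> n \<Longrightarrow> e i \<le> e j"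
    and "i \<in> {1..n}" "j \<in> {1..n}" "e (i - 1) < x" "x < e i" "e (j - 1) < x" "x < e j"
  shows "i = j"
proof (rule linorder_cases[of i j])
  assume "i < j"
  then show ?thesis using assms(2-) mono[of i "j - 1"] by force
next
  assume "j < i"
  then show ?thesis using assms(2-) mono[of j "i - 1"] by force
qed

context linear_involution_data
begin

lemma pi_closed: "i \<in> {1..l + m} \<Longrightarrow> \<pi> i \<in> A"
  using perm by (auto simp: bij_betw_def)

lemma len_pi_pos: "i \<in> {1..l + m} \<Longrightarrow> 0 < len (\<pi> i)"
  using pi_closed len_pos by blast

lemma top_end_0: "top_end 0 = lo" and top_end_l: "top_end l = hi"
  using len_top by (auto simp: top_end_def)

lemma bottom_end_0: "bottom_end 0 = lo" and bottom_end_m: "bottom_end m = hi"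
  using len_bottom by (auto simp: bottom_end_def)

lemma top_end_Suc: "top_end (Suc i) = top_end i + len (\<pi> (Suc i))"
  by (simp add: top_end_def)

lemma bottom_end_Suc: "bottom_end (Suc i) = bottom_end i + len (\<pi> (Suc (l + i)))"
  by (simp add: bottom_end_def)

lemma top_end_mono: "i \<le> j \<Longrightarrow> j \<le> l \<Longrightarrow> top_end i \<le> top_end j"
proof (induction j rule: dec_induct)
  case (step n)
  then show ?case using len_pi_pos[of "Suc n"] by (simp add: top_end_Suc)
qed simp

lemma bottom_end_mono: "i \<le> j \<Longrightarrow> j \<le> m \<Longrightarrow> bottom_end i \<le> bottom_end j"
proof (induction j rule: dec_induct)
  case (step n)
  then show ?case using len_pi_pos[of "Suc (l + n)"] by (simp add: bottom_end_Suc)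
qed simp

lemma letter_interval_pi:
  "i \<in> {1..l + m} \<Longrightarrow> letter_interval (\<pi> i) = indexed_interval i"
  using perm by (simp add: letter_interval_def bij_betw_def)

text \<open>The bottom index is shifted to start at 1, so that arguments for the two components run
  in parallel.\<close>

lemma letter_cases:
  assumes "a \<in> A"
  obtains (top) i where "i \<in> {1..l}" "a = \<pi> i"
      "letter_interval a = {top_end (i - 1)<..<top_end i} \<times> {0}"
    | (bottom) j where "j \<in> {1..m}" "a = \<pi> (l + j)"
      "letter_interval a = {bottom_end (j - 1)<..<bottom_end j} \<times> {1}"
proof -
  obtain i where i: "i \<in> {1..l + m}" "a = \<pi> i" using assms perm by (auto simp: bij_betw_def)
  show ?thesis
  proof (cases "i \<le> l")
    case True
    then show ?thesis using i top[of i] letter_interval_pi[of i] by (auto simp: indexed_interval_def)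
  next
    case False
    moreover from False i have "i - l \<in> {1..m}" "a = \<pi> (l + (i - l))" by auto
    ultimately show ?thesis using i bottom[of "i - l"] letter_interval_pi[of i]
      by (simp add: indexed_interval_def)
  qed
qed

lemma letter_interval_cases:
  assumes "a \<in> A"
  obtains c d \<delta> where "c < d" "\<delta> \<in> {0, 1}" "letter_interval a = {c<..<d} \<times> {\<delta>}"
  using assms
proof (cases a rule: letter_cases)
  case (top i)
  then show ?thesis using that[of "top_end (i - 1)" "top_end i" 0] top_end_Suc[of "i - 1"] len_pos[OF assms]
    by auto
next
  case (bottom j)
  then show ?thesis
    using that[of "bottom_end (j - 1)" "bottom_end j" 1] bottom_end_Suc[of "j - 1"] len_pos[OF assms]
    by auto
qed

lemma letter_interval_nonempty: "a \<in> A \<Longrightarrow> letter_interval a \<noteq> {}"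
  by (erule letter_interval_cases) (simp add: Sigma_empty_iff)

text \<open>This one fact is behind both the reducedness of coded words and the disjointness of the
  two trees of the empty word.\<close>

lemma letter_interval_component:
  "a \<in> A \<Longrightarrow> (x, \<delta>) \<in> letter_interval a \<Longrightarrow> (y, \<epsilon>) \<in> letter_interval a \<Longrightarrow> \<delta> = \<epsilon>"
  by (erule letter_interval_cases) auto

lemma letter_interval_disjoint:
  assumes "a \<in> A" "b \<in> A" "z \<in> letter_interval a" "z \<in> letter_interval b"
  shows "a = b"
  using assms(1)
proof (cases a rule: letter_cases)
  case (top i)
  note i = this
  show ?thesis using assms(2)
  proof (cases b rule: letter_cases)
    case (top j)
    have "fst z \<in> {top_end (i - 1)<..<top_end i}" "fst z \<in> {top_end (j - 1)<..<top_end j}"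
      using assms(3,4) unfolding i(3) top(3) by auto
    then have "i = j"
      using subdivision_unique[where e = top_end and n = l and x = "fst z", OF _ i(1) top(1)] top_end_mono
      by (metis greaterThanLessThan_iff)
    then show ?thesis using i(2) top(2) by simp
  next
    case (bottom j)
    then show ?thesis using assms(3,4) unfolding i(3) bottom(3) by auto
  qed
next
  case (bottom i)
  note i = this
  show ?thesis using assms(2)
  proof (cases b rule: letter_cases)
    case (bottom j)
    have "fst z \<in> {bottom_end (i - 1)<..<bottom_end i}" "fst z \<in> {bottom_end (j - 1)<..<bottom_end j}"
      using assms(3,4) unfolding i(3) bottom(3) by auto
    then have "i = j"
      using subdivision_unique[where e = bottom_end and n = m and x = "fst z", OF _ i(1) bottom(1)] bottom_end_mono
      by (metis greaterThanLessThan_iff)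
    then show ?thesis using i(2) bottom(2) by simp
  next
    case (top j)
    then show ?thesis using assms(3,4) unfolding i(3) top(3) by auto
  qed
qed

lemma letter_interval_subset:
  assumes a: "a \<in> A"
  shows "letter_interval a \<subseteq> I_hat - division_points"
  using a
proof (cases a rule: letter_cases)
  case (top i)
  have "top_end 0 \<le> top_end (i - 1)" "top_end i \<le> top_end l"
    by (rule top_end_mono; use top(1) in auto)+
  \<comment> \<open>By monotonicity every endpoint is at most \<open>top_end (i - 1)\<close> or at
    least \<open>top_end i\<close>, so none falls strictly inside the interval.\<close>
  moreover have "\<not> (top_end (i - 1) < top_end j \<and> top_end j < top_end i)" if "j < l" for j
  proof (cases "j < i")
    case True
    then have "j \<le> i - 1" "i - 1 \<le> l" using top(1) by auto
    then show ?thesis using top_end_mono[of j "i - 1"] by simp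
  next
    case False
    then show ?thesis using that top_end_mono[of i j] by simp
  qed
  ultimately have bounds: "x \<in> {lo<..<hi}" "j < l \<Longrightarrow> x \<noteq> top_end j"
    if "x \<in> {top_end (i - 1)<..<top_end i}" for x j
    using that top_end_0 top_end_l by auto
  show ?thesis
  proof
    fix z assume "z \<in> letter_interval a"
    then obtain x where z: "z = (x, 0)" and x: "x \<in> {top_end (i - 1)<..<top_end i}"
      unfolding top(3) by blast
    then have "z \<notin> division_points" using bounds(2)[OF x] by (auto simp: division_points_def)
    then show "z \<in> I_hat - division_points" using bounds(1)[OF x] z by (simp add: I_hat_def)
  qed
next
  case (bottom i)
  have "bottom_end 0 \<le> bottom_end (i - 1)" "bottom_end i \<le> bottom_end m"
    by (rule bottom_end_mono; use bottom(1) in auto)+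
  moreover have "\<not> (bottom_end (i - 1) < bottom_end j \<and> bottom_end j < bottom_end i)" if "j < m" for j
  proof (cases "j < i")
    case True
    then have "j \<le> i - 1" "i - 1 \<le> m" using bottom(1) by auto
    then show ?thesis using bottom_end_mono[of j "i - 1"] by simp
  next
    case False
    then show ?thesis using that bottom_end_mono[of i j] by simp
  qed
  ultimately have bounds: "x \<in> {lo<..<hi}" "j < m \<Longrightarrow> x \<noteq> bottom_end j"
    if "x \<in> {bottom_end (i - 1)<..<bottom_end i}" for x j
    using that bottom_end_0 bottom_end_m by auto
  show ?thesis
  proof
    fix z assume "z \<in> letter_interval a"
    then obtain x where z: "z = (x, 1)" and x: "x \<in> {bottom_end (i - 1)<..<bottom_end i}"
      unfolding bottom(3) by blast
    then have "z \<notin> division_points" using bounds(2)[OF x] by (auto simp: division_points_def)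
    then show "z \<in> I_hat - division_points" using bounds(1)[OF x] z by (simp add: I_hat_def)
  qed
qed

text \<open>Together with disjointness, this gives every point where \<open>T\<close> is defined
  exactly one letter.\<close>

lemma letter_interval_exists:
  assumes "z \<in> I_hat" "z \<notin> division_points"
  shows "\<exists>a\<in>A. z \<in> letter_interval a"
proof -
  obtain x \<delta> where z: "z = (x, \<delta>)" by (cases z)
  have x: "lo < x" "x < hi" and "\<delta> = 0 \<or> \<delta> = 1" using assms by (auto simp: z I_hat_def)
  then consider "\<delta> = 0" | "\<delta> = 1" by blast
  then show ?thesis
  proof cases
    case 1
    have "\<exists>i\<in>{1..l}. top_end (i - 1) < x \<and> x < top_end i"
      using assms x 1 by (intro subdivision_cover) (auto simp: z division_points_def top_end_0 top_end_l)
    then obtain i where "i \<in> {1..l}" "top_end (i - 1) < x" "x < top_end i" by blast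
    then show ?thesis using letter_interval_pi[of i] pi_closed[of i]
      by (intro bexI[of _ "\<pi> i"]) (auto simp: z 1 indexed_interval_def)
  next
    case 2
    have "\<exists>i\<in>{1..m}. bottom_end (i - 1) < x \<and> x < bottom_end i"
      using assms x 2 by (intro subdivision_cover) (auto simp: z division_points_def bottom_end_0 bottom_end_m)
    then obtain i where "i \<in> {1..m}" "bottom_end (i - 1) < x" "x < bottom_end i" by blast
    then show ?thesis using letter_interval_pi[of "l + i"] pi_closed[of "l + i"]
      by (intro bexI[of _ "\<pi> (l + i)"]) (auto simp: z 2 indexed_interval_def)
  qed
qed

lemma finite_division_points: "finite division_points"
proof -
  have "division_points \<subseteq> (\<lambda>i. (top_end i, 0)) ` {..<l} \<union> (\<lambda>j. (bottom_end j, 1)) ` {..<m}"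
    by (auto simp: division_points_def)
  then show ?thesis by (rule finite_subset) auto
qed

text \<open>Components are natural numbers and \<open>1 - \<delta>\<close> truncates, so flipping is
  an involution only for \<open>\<delta>\<close> in \<open>{0, 1}\<close>; membership in
  \<open>I_hat\<close> ensures this.\<close>

lemma flip_flip: "z \<in> I_hat \<Longrightarrow> flip_component (flip_component z) = z"
  and flip_closed: "z \<in> I_hat \<Longrightarrow> flip_component z \<in> I_hat"
  by (auto simp: I_hat_def flip_component_def)

end

section \<open>Cylinders\<close>

context linear_involution
begin

definition \<tau> :: "real \<times> nat \<Rightarrow> real \<times> nat" where
  "\<tau> z = flip_component (\<sigma>1 z)"

text \<open>The condition on \<open>I_hat\<close> makes the cylinder of the empty word the whole
  two-component interval.\<close>

definition cyl :: "'a list \<Rightarrow> (real \<times> nat) set" where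
  "cyl w = {z \<in> I_hat. \<forall>i<length w. (\<tau> ^^ i) z \<in> letter_interval (w ! i)}"

section \<open>Elementary properties of the total map and of cylinders\<close>

lemma sigma1_letter: "a \<in> A \<Longrightarrow> z \<in> letter_interval a \<Longrightarrow> \<sigma>1 z \<in> letter_interval (\<theta> a)"
  using sigma1_onto by blast

lemma letter_in_I_hat: "a \<in> A \<Longrightarrow> z \<in> letter_interval a \<Longrightarrow> z \<in> I_hat"
  using letter_interval_subset by blast

lemma flip_tau:
  assumes "a \<in> A" "z \<in> letter_interval a"
  shows "flip_component (\<tau> z) = \<sigma>1 z"
  using flip_flip letter_in_I_hat[OF theta_closed[OF assms(1)] sigma1_letter[OF assms]]
  by (simp add: \<tau>_def)

lemma tau_in_I_hat:
  assumes "a \<in> A" "z \<in> letter_interval a"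
  shows "\<tau> z \<in> I_hat"
  using flip_closed letter_in_I_hat[OF theta_closed[OF assms(1)] sigma1_letter[OF assms]]
  by (simp add: \<tau>_def)

lemma sigma1_sigma1_letter: "a \<in> A \<Longrightarrow> z \<in> letter_interval a \<Longrightarrow> \<sigma>1 (\<sigma>1 z) = z"
  using letter_interval_subset sigma1_involution by blast

text \<open>As \<open>\<tau>\<close> applies \<open>\<sigma>1\<close> and then the flip, both
  involutions, its inverse applies them in the opposite order.\<close>

lemma tau_preimage:
  assumes "a \<in> A" "z \<in> I_hat" "flip_component z \<in> letter_interval (\<theta> a)"
  obtains y where "y \<in> letter_interval a" "\<tau> y = z"
proof
  show "\<sigma>1 (flip_component z) \<in> letter_interval a"
    using sigma1_letter[OF theta_closed[OF assms(1)] assms(3)] theta_involution[OF assms(1)] by simp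
  show "\<tau> (\<sigma>1 (flip_component z)) = z"
    using sigma1_sigma1_letter[OF theta_closed[OF assms(1)] assms(3)] flip_flip[OF assms(2)]
    by (simp add: \<tau>_def)
qed

lemma cyl_Nil: "cyl [] = I_hat"
  by (simp add: cyl_def)

lemma cyl_subset: "cyl w \<subseteq> I_hat"
  by (auto simp: cyl_def)

lemma cyl_Cons:
  assumes "a \<in> A"
  shows "cyl (a # w) = {z \<in> letter_interval a. \<tau> z \<in> cyl w}"
proof (intro set_eqI)
  fix z
  \<comment> \<open>The two cylinders ask for membership in \<open>I_hat\<close> of different
    points, \<open>z\<close> and \<open>\<tau> z\<close>; on the interval of \<open>a\<close> both
    hold.\<close>
  have "z \<in> I_hat \<and> z \<in> letter_interval a \<longleftrightarrow> z \<in> letter_interval a \<and> \<tau> z \<in> I_hat"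
    using letter_in_I_hat[OF assms, of z] tau_in_I_hat[OF assms, of z] by blast
  then show "z \<in> cyl (a # w) \<longleftrightarrow> z \<in> {z \<in> letter_interval a. \<tau> z \<in> cyl w}"
    by (simp add: cyl_def All_less_Suc2 funpow_swap1) blast
qed

lemma cyl_single: "a \<in> A \<Longrightarrow> cyl [a] = letter_interval a"
  using tau_in_I_hat by (simp add: cyl_Cons cyl_Nil) blast

lemma cyl_snoc: "cyl (w @ [b]) = {z \<in> cyl w. (\<tau> ^^ length w) z \<in> letter_interval b}"
  by (auto simp: cyl_def All_less_Suc nth_append)

lemma cyl_append_subset: "cyl (u @ v) \<subseteq> cyl u"
proof
  fix z assume z: "z \<in> cyl (u @ v)"
  have "(\<tau> ^^ i) z \<in> letter_interval (u ! i)" if "i < length u" for i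
    using z that by (auto simp: cyl_def nth_append dest: spec[of _ i])
  then show "z \<in> cyl u" using z by (simp add: cyl_def)
qed

lemma funpow_tau_in_I_hat: "w \<in> lists A \<Longrightarrow> z \<in> cyl w \<Longrightarrow> (\<tau> ^^ length w) z \<in> I_hat"
proof (induction w arbitrary: z rule: list.induct)
  case (Cons a w)
  then have "(\<tau> ^^ length w) (\<tau> z) \<in> I_hat" by (simp add: cyl_Cons)
  then show ?case by (simp add: funpow_swap1)
qed (simp add: cyl_def)

section \<open>Orbits of the partial map and infinite codings\<close>

lemma T_eq: "z \<in> I_hat - division_points \<Longrightarrow> T z = Some (\<tau> z)"
  by (simp add: T_def \<tau>_def)

lemma T_pow_eq: "T_pow n z = Some p \<Longrightarrow> p = (\<tau> ^^ n) z"
proof (induction n arbitrary: p)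
  case (Suc n)
  then obtain q where "T_pow n z = Some q" "T q = Some p" by (auto simp: bind_eq_Some_conv)
  then show ?case using Suc.IH[of q] by (auto simp: T_def \<tau>_def split: if_splits)
qed simp

text \<open>The bound includes \<open>n = length w\<close>: the last iterate is defined even if it
  is a division point, which is how a connection will be detected.\<close>

lemma T_pow_cyl:
  assumes "w \<in> lists A" "z \<in> cyl w"
  shows "n \<le> length w \<Longrightarrow> T_pow n z = Some ((\<tau> ^^ n) z)"
proof (induction n)
  case (Suc n)
  have "(\<tau> ^^ n) z \<in> letter_interval (w ! n)" using Suc.prems assms(2) by (simp add: cyl_def)
  moreover have "w ! n \<in> A" using Suc.prems assms(1) by (simp add: in_lists_conv_set)
  ultimately have "(\<tau> ^^ n) z \<in> I_hat - division_points" using letter_interval_subset by blast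
  then show ?case using Suc by (simp add: T_eq)
qed simp

text \<open>The inverse of \<open>T\<close> extends to a total map \<open>g\<close>, so every
  excluded point is an iterate under \<open>g\<close> of one of finitely many division
  points.\<close>

lemma countable_orbit_set: "countable orbit_set"
proof -
  define g where "g = \<sigma>1 \<circ> flip_component"
  have prev: "z = g p" if "T z = Some p" for z p
    using that flip_flip[OF sigma1_closed[THEN DiffD1, of z]] sigma1_involution[of z]
    by (auto simp: T_def g_def split: if_splits)
  have "z = (g ^^ n) p" if "T_pow n z = Some p" for n z p
    using that
  proof (induction n arbitrary: p)
    case (Suc n)
    then obtain q where "T_pow n z = Some q" "T q = Some p" by (auto simp: bind_eq_Some_conv)
    then show ?case using Suc.IH[of q] prev[of q p] by (simp add: funpow_swap1)
  qed simp
  then have "orbit_set \<subseteq> (\<Union>n. (g ^^ n) ` division_points)"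
    unfolding orbit_set_def by blast
  moreover have "countable (\<Union>n. (g ^^ n) ` division_points)"
    by (simp add: countable_finite finite_division_points)
  ultimately show ?thesis by (rule countable_subset)
qed

lemma infinite_coding_exists:
  assumes "z \<in> I_hat" "z \<notin> orbit_set"
  obtains w where "infinite_coding z w"
proof -
  \<comment> \<open>The orbit never stops: reaching a division point after \<open>n\<close> steps
    would put \<open>z\<close> into \<open>orbit_set\<close>.\<close>
  have "\<exists>p. T_pow n z = Some p \<and> p \<in> I_hat \<and> p \<notin> division_points" for n
  proof (induction n)
    case 0
    have "z \<notin> division_points"
    proof
      assume "z \<in> division_points"
      then have "T_pow 0 z = Some z \<and> z \<in> division_points" by simp
      then show False using assms unfolding orbit_set_def by blast
    qed
    then show ?case using assms by simp
  next
    case (Suc n)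
    then obtain p where p: "T_pow n z = Some p" "p \<in> I_hat - division_points" by blast
    then have eq: "T_pow (Suc n) z = Some (\<tau> p)" by (simp add: T_def \<tau>_def)
    moreover have "\<tau> p \<in> I_hat"
      using sigma1_closed[OF p(2)] flip_closed by (simp add: \<tau>_def)
    moreover have "\<tau> p \<notin> division_points" using eq assms unfolding orbit_set_def by blast
    ultimately show ?case by blast
  qed
  then have "\<exists>a. a \<in> A \<and> (\<exists>p. T_pow n z = Some p \<and> p \<in> letter_interval a)" for n
    using letter_interval_exists by metis
  then have "\<exists>w. \<forall>n. w n \<in> A \<and> (\<exists>p. T_pow n z = Some p \<and> p \<in> letter_interval (w n))"
    by (intro choice) blast
  then show ?thesis using that unfolding infinite_coding_def by blast
qed

lemma infinite_coding_letter:
  assumes "infinite_coding z w"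
  shows "w n \<in> A" "(\<tau> ^^ n) z \<in> letter_interval (w n)"
  using assms T_pow_eq unfolding infinite_coding_def by blast+

lemma infinite_coding_cyl:
  assumes "infinite_coding z w"
  shows "(\<tau> ^^ i) z \<in> cyl (map w [i..<j])"
proof -
  have "(\<tau> ^^ n) ((\<tau> ^^ i) z) \<in> letter_interval (w (i + n))" for n
    using infinite_coding_letter(2)[OF assms, of "n + i"] by (metis add.commute comp_apply funpow_add)
  moreover have "(\<tau> ^^ i) z \<in> I_hat"
    using infinite_coding_letter[OF assms, of i] letter_in_I_hat by blast
  ultimately show ?thesis by (simp add: cyl_def)
qed

section \<open>Affine form of the iterates on cylinders\<close>

lemma letter_preimage_interval:
  assumes "a \<in> A" "s = 1 \<or> s = -1"
  shows "\<exists>u v. {x \<in> {c<..<d}. (s * x + \<alpha>, \<gamma>) \<in> letter_interval a} = {u<..<v}"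
proof -
  obtain c' d' \<delta> where I: "letter_interval a = {c'<..<d'} \<times> {\<delta>}"
    using letter_interval_cases[OF assms(1)] by metis
  consider "\<gamma> \<noteq> \<delta>" | "\<gamma> = \<delta>" "s = 1" | "\<gamma> = \<delta>" "s = -1" using assms(2) by blast
  then show ?thesis
  proof cases
    case 1
    \<comment> \<open>If the components disagree the preimage is empty; \<open>{0<..<0}\<close>
      writes the empty set as an open interval.\<close>
    then have "{x \<in> {c<..<d}. (s * x + \<alpha>, \<gamma>) \<in> letter_interval a} = {0<..<0}" by (auto simp: I)
    then show ?thesis by blast
  next
    case 2
    then have "{x \<in> {c<..<d}. (s * x + \<alpha>, \<gamma>) \<in> letter_interval a}
        = {max c (c' - \<alpha>)<..<min d (d' - \<alpha>)}" by (auto simp: I)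
    then show ?thesis by blast
  next
    case 3
    then have "{x \<in> {c<..<d}. (s * x + \<alpha>, \<gamma>) \<in> letter_interval a}
        = {max c (\<alpha> - d')<..<min d (\<alpha> - c')}" by (auto simp: I)
    then show ?thesis by blast
  qed
qed

text \<open>The slope \<open>s\<close> treats translations and symmetries alike, so that composing
  branches only multiplies signs.\<close>

lemma tau_affine:
  assumes "a \<in> A"
  obtains s \<alpha> \<gamma> where "s = 1 \<or> s = -1"
    "\<And>x \<delta>. (x, \<delta>) \<in> letter_interval a \<Longrightarrow> \<tau> (x, \<delta>) = (s * x + \<alpha>, \<gamma>)"
proof -
  obtain \<alpha> \<gamma> where "(\<forall>(x, \<delta>) \<in> letter_interval a. \<sigma>1 (x, \<delta>) = (x + \<alpha>, \<gamma>)) \<or>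
         (\<forall>(x, \<delta>) \<in> letter_interval a. \<sigma>1 (x, \<delta>) = (- x + \<alpha>, \<gamma>))"
    using sigma1_isometry[OF assms] by blast
  then show ?thesis
  proof
    assume "\<forall>(x, \<delta>) \<in> letter_interval a. \<sigma>1 (x, \<delta>) = (x + \<alpha>, \<gamma>)"
    then have "\<tau> (x, \<delta>) = (1 * x + \<alpha>, 1 - \<gamma>)" if "(x, \<delta>) \<in> letter_interval a" for x \<delta>
      using that by (fastforce simp: \<tau>_def flip_component_def)
    then show ?thesis by (rule that[of 1, rotated]) simp_all
  next
    assume "\<forall>(x, \<delta>) \<in> letter_interval a. \<sigma>1 (x, \<delta>) = (- x + \<alpha>, \<gamma>)"
    then have "\<tau> (x, \<delta>) = (-1 * x + \<alpha>, 1 - \<gamma>)" if "(x, \<delta>) \<in> letter_interval a" for x \<delta>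
      using that by (fastforce simp: \<tau>_def flip_component_def)
    then show ?thesis by (rule that[of "-1", rotated]) simp_all
  qed
qed

text \<open>Appending a letter \<open>b\<close> keeps those points whose current affine image lies
  in the interval of \<open>b\<close>. This preimage is again an open interval, possibly empty, and
  the new iterate is a composition of affine maps. The word is nonempty because
  \<open>cyl []\<close> has two components.\<close>

lemma cyl_affine:
  assumes "w \<in> lists A" "w \<noteq> []"
  shows "\<exists>c d \<delta> s \<alpha> \<gamma>. cyl w = {c<..<d} \<times> {\<delta>} \<and> (s = 1 \<or> s = -1) \<and>
    (\<forall>x\<in>{c<..<d}. (\<tau> ^^ length w) (x, \<delta>) = (s * x + \<alpha>, \<gamma>))"
  using assms
proof (induction w rule: rev_induct)
  case (snoc b w)
  then have b: "b \<in> A" and w: "w \<in> lists A" by auto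
  obtain s\<^sub>b \<alpha>\<^sub>b \<gamma>\<^sub>b where s\<^sub>b: "s\<^sub>b = 1 \<or> s\<^sub>b = -1"
    and \<tau>\<^sub>b: "\<And>x \<delta>. (x, \<delta>) \<in> letter_interval b \<Longrightarrow> \<tau> (x, \<delta>) = (s\<^sub>b * x + \<alpha>\<^sub>b, \<gamma>\<^sub>b)"
    using tau_affine[OF b] by metis
  show ?case
  \<comment> \<open>The induction really starts at one-letter words, since the hypothesis speaks of
    nonempty \<open>w\<close> only.\<close>
  proof (cases "w = []")
    case True
    obtain c d \<delta> where I: "letter_interval b = {c<..<d} \<times> {\<delta>}"
      using letter_interval_cases[OF b] by metis
    then have "cyl (w @ [b]) = {c<..<d} \<times> {\<delta>}" using True cyl_single[OF b] by simp
    moreover have "\<forall>x\<in>{c<..<d}. (\<tau> ^^ length (w @ [b])) (x, \<delta>) = (s\<^sub>b * x + \<alpha>\<^sub>b, \<gamma>\<^sub>b)"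
      using True \<tau>\<^sub>b[unfolded I] by simp
    ultimately show ?thesis using s\<^sub>b by metis
  next
    case False
    then obtain c d \<delta> s \<alpha> \<gamma> where cyl: "cyl w = {c<..<d} \<times> {\<delta>}" and s: "s = 1 \<or> s = -1"
      and \<tau>: "\<And>x. x \<in> {c<..<d} \<Longrightarrow> (\<tau> ^^ length w) (x, \<delta>) = (s * x + \<alpha>, \<gamma>)"
      using snoc.IH[OF w] by metis
    obtain u v where uv: "{x \<in> {c<..<d}. (s * x + \<alpha>, \<gamma>) \<in> letter_interval b} = {u<..<v}"
      using letter_preimage_interval[OF b s] by metis
    have mem: "x \<in> {u<..<v} \<longleftrightarrow> x \<in> {c<..<d} \<and> (s * x + \<alpha>, \<gamma>) \<in> letter_interval b" for x
      unfolding uv[symmetric] by simp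
    have "(x, \<epsilon>) \<in> cyl (w @ [b]) \<longleftrightarrow> (x, \<epsilon>) \<in> {u<..<v} \<times> {\<delta>}" for x \<epsilon>
      unfolding cyl_snoc mem_Collect_eq cyl mem mem_Times_iff using \<tau>[of x] by auto
    then have "cyl (w @ [b]) = {u<..<v} \<times> {\<delta>}" by auto
    moreover have "\<forall>x\<in>{u<..<v}. (\<tau> ^^ length (w @ [b])) (x, \<delta>) =
        (s\<^sub>b * s * x + (s\<^sub>b * \<alpha> + \<alpha>\<^sub>b), \<gamma>\<^sub>b)"
    proof
      fix x assume "x \<in> {u<..<v}"
      then have x: "x \<in> {c<..<d}" "(s * x + \<alpha>, \<gamma>) \<in> letter_interval b" by (simp_all only: mem)
      show "(\<tau> ^^ length (w @ [b])) (x, \<delta>) = (s\<^sub>b * s * x + (s\<^sub>b * \<alpha> + \<alpha>\<^sub>b), \<gamma>\<^sub>b)"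
        using \<tau>[OF x(1)] \<tau>\<^sub>b[OF x(2)] by (simp add: algebra_simps)
    qed
    moreover have "s\<^sub>b * s = 1 \<or> s\<^sub>b * s = -1" using s s\<^sub>b by auto
    ultimately show ?thesis by metis
  qed
qed simp

text \<open>A nonempty cylinder contains a nondegenerate interval, so countably many exceptional
  points cannot fill it.\<close>

lemma uncountable_cyl:
  assumes "w \<in> lists A" "cyl w \<noteq> {}"
  shows "uncountable (cyl w)"
proof -
  have "\<exists>c d \<delta>. c < d \<and> {c<..<d} \<times> {\<delta>} \<subseteq> cyl w"
  proof (cases "w = []")
    case True
    then show ?thesis using interval_nonempty
      by (intro exI[of _ lo] exI[of _ hi] exI[of _ 0]) (auto simp: cyl_Nil I_hat_def)
  next
    case False
    then obtain c d \<delta> where "cyl w = {c<..<d} \<times> {\<delta>}" using cyl_affine[OF assms(1)] by metis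
    moreover from this have "c < d" using assms(2) by (cases "c < d") auto
    ultimately show ?thesis by blast
  qed
  then obtain c d \<delta> where "c < d" and sub: "{c<..<d} \<times> {\<delta>} \<subseteq> cyl w" by blast
  then have "uncountable {c<..<d}" by (simp add: uncountable_open_interval)
  moreover have "{c<..<d} \<subseteq> fst ` cyl w" using sub by force
  ultimately show ?thesis by (meson countable_image countable_subset)
qed

text \<open>A factor of a coding is read from the corresponding iterate of the starting point.
  Conversely, a nonempty cylinder is uncountable and so contains a point outside the countable set
  \<open>orbit_set_hat\<close>.\<close>

lemma natural_coding_eq: "natural_coding = {w \<in> lists A. cyl w \<noteq> {}}"
proof (intro equalityI subsetI)
  fix u assume "u \<in> natural_coding"
  then obtain w i j z where u: "u = map w [i..<j]" and z: "infinite_coding z w"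
    unfolding natural_coding_def by blast
  then show "u \<in> {w \<in> lists A. cyl w \<noteq> {}}"
    using infinite_coding_cyl[OF z, of i j] infinite_coding_letter(1)[OF z] by auto
next
  fix u assume "u \<in> {w \<in> lists A. cyl w \<noteq> {}}"
  then have u: "u \<in> lists A" "cyl u \<noteq> {}" by auto
  have "countable orbit_set_hat" by (simp add: orbit_set_hat_def countable_orbit_set)
  then have "\<not> cyl u \<subseteq> orbit_set_hat" using uncountable_cyl[OF u] countable_subset by blast
  then obtain z where z: "z \<in> cyl u" "z \<notin> orbit_set_hat" by blast
  then have zI: "z \<in> I_hat" using cyl_subset by blast
  obtain w where w: "infinite_coding z w"
    using infinite_coding_exists[OF zI] z(2) by (auto simp: orbit_set_hat_def)
  \<comment> \<open>Disjointness of the letter intervals forces the coding of a point of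
    \<open>cyl u\<close> to begin with \<open>u\<close>.\<close>
  have "map w [0..<length u] = u"
  proof (rule nth_equalityI)
    fix i assume "i < length (map w [0..<length u])"
    then have i: "i < length u" by simp
    then have "(\<tau> ^^ i) z \<in> letter_interval (u ! i)" "u ! i \<in> A"
      using z(1) u(1) by (auto simp: cyl_def in_lists_conv_set)
    then show "map w [0..<length u] ! i = u ! i"
      using letter_interval_disjoint infinite_coding_letter[OF w, of i] i by simp
  qed simp
  then show "u \<in> natural_coding"
    unfolding natural_coding_def using z(2) zI w by (intro CollectI exI[of _ w] exI[of _ 0] exI[of _ "length u"]) auto
qed

lemma natural_coding_lists: "w \<in> natural_coding \<Longrightarrow> w \<in> lists A"
  by (simp add: natural_coding_eq)

section \<open>The specular properties\<close>

text \<open>The map \<open>\<tau>\<close> carries the interval of \<open>a\<close> onto the flip of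
  the interval of \<open>\<theta> a\<close>, so prepending \<open>a\<close> becomes a condition on
  \<open>z = \<tau> y\<close>. The predicate \<open>R\<close> lets one statement serve left and
  two-sided extensions.\<close>

lemma left_extension:
  assumes "a \<in> A"
  shows "(\<exists>y. y \<in> cyl (a # w) \<and> R (\<tau> y)) \<longleftrightarrow>
    (\<exists>z\<in>cyl w. flip_component z \<in> letter_interval (\<theta> a) \<and> R z)"
proof
  assume "\<exists>y. y \<in> cyl (a # w) \<and> R (\<tau> y)"
  then obtain y where "y \<in> letter_interval a" "\<tau> y \<in> cyl w" "R (\<tau> y)"
    using cyl_Cons[OF assms] by blast
  then show "\<exists>z\<in>cyl w. flip_component z \<in> letter_interval (\<theta> a) \<and> R z"
    using flip_tau[OF assms] sigma1_letter[OF assms] by (intro bexI[of _ "\<tau> y"]) auto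
next
  assume "\<exists>z\<in>cyl w. flip_component z \<in> letter_interval (\<theta> a) \<and> R z"
  then obtain z where z: "z \<in> cyl w" "flip_component z \<in> letter_interval (\<theta> a)" "R z" by blast
  moreover have "z \<in> I_hat" using z(1) cyl_subset by blast
  ultimately obtain y where "y \<in> letter_interval a" "\<tau> y = z" using tau_preimage[OF assms] by metis
  then show "\<exists>y. y \<in> cyl (a # w) \<and> R (\<tau> y)"
    using z(1,3) by (intro exI[of _ y]) (simp add: cyl_Cons[OF assms])
qed

lemma left_ext_eq:
  assumes "w \<in> lists A"
  shows "left_ext A natural_coding w =
    {a \<in> A. \<exists>z\<in>cyl w. flip_component z \<in> letter_interval (\<theta> a)}"
proof -
  have "cyl (a # w) \<noteq> {} \<longleftrightarrow> (\<exists>z\<in>cyl w. flip_component z \<in> letter_interval (\<theta> a))"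
    if "a \<in> A" for a
    using left_extension[OF that, where R = "\<lambda>_. True" and w = w] by auto
  then show ?thesis using assms by (auto simp: left_ext_def natural_coding_eq)
qed

lemma right_ext_eq:
  assumes "w \<in> lists A"
  shows "right_ext A natural_coding w =
    {b \<in> A. \<exists>z\<in>cyl w. (\<tau> ^^ length w) z \<in> letter_interval b}"
proof -
  have "w @ [b] \<in> natural_coding \<longleftrightarrow> (\<exists>z\<in>cyl w. (\<tau> ^^ length w) z \<in> letter_interval b)"
    if "b \<in> A" for b
    using assms that by (auto simp: natural_coding_eq cyl_snoc)
  then show ?thesis unfolding right_ext_def by blast
qed

lemma bi_ext_eq:
  assumes "w \<in> lists A"
  shows "bi_ext A natural_coding w =
    {(a, b) \<in> A \<times> A. \<exists>z\<in>cyl w. flip_component z \<in> letter_interval (\<theta> a) \<and>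
      (\<tau> ^^ length w) z \<in> letter_interval b}"
proof -
  have "a # w @ [b] \<in> natural_coding \<longleftrightarrow> (\<exists>z\<in>cyl w. flip_component z \<in> letter_interval (\<theta> a) \<and>
      (\<tau> ^^ length w) z \<in> letter_interval b)" if "a \<in> A" "b \<in> A" for a b
  proof -
    have "a # w @ [b] \<in> natural_coding \<longleftrightarrow> (\<exists>y. y \<in> cyl (a # w @ [b]))"
      using assms that by (auto simp: natural_coding_eq)
    also have "\<dots> \<longleftrightarrow> (\<exists>y. y \<in> cyl (a # w) \<and> (\<tau> ^^ length w) (\<tau> y) \<in> letter_interval b)"
      using cyl_snoc[of "a # w" b] by (simp add: funpow_swap1)
    finally show ?thesis using left_extension[OF that(1)] by simp
  qed
  then show ?thesis by (auto simp: bi_ext_def)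
qed

section \<open>Factors, reducedness and inverses\<close>

lemma factorial_natural_coding: "factorial_set A natural_coding"
  unfolding factorial_set_def
proof (intro conjI ballI allI impI subsetI)
  show "[a] \<in> natural_coding" if "a \<in> A" for a
    using that cyl_single letter_interval_nonempty by (simp add: natural_coding_eq)
  fix w u assume w: "w \<in> natural_coding" and "sublist u w"
  then obtain p q where eq: "w = p @ u @ q" by (auto simp: sublist_def)
  \<comment> \<open>The suffix \<open>q\<close> is dropped by inclusion of cylinders; the prefix
    \<open>p\<close> is then removed letter by letter by applying \<open>\<tau>\<close>.\<close>
  have "cyl (p @ u) \<noteq> {}" using w cyl_append_subset[of "p @ u" q] by (auto simp: natural_coding_eq eq)
  moreover have "p @ u \<in> lists A" using w by (auto simp: natural_coding_eq eq)
  ultimately have "cyl u \<noteq> {} \<and> u \<in> lists A"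
  proof (induction p)
    case (Cons a p)
    then have "cyl (p @ u) \<noteq> {}" "p @ u \<in> lists A" using cyl_Cons[of a "p @ u"] by auto
    then show ?case by (rule Cons.IH)
  qed simp
  then show "u \<in> natural_coding" by (simp add: natural_coding_eq)
qed (rule natural_coding_lists)

text \<open>If \<open>z\<close> and \<open>\<tau> z\<close> had letters \<open>a\<close> and
  \<open>\<theta> a\<close>, then \<open>\<sigma>1 z\<close> and its flip would both lie in the
  interval of \<open>\<theta> a\<close>, hence in the same component.\<close>

lemma reduced_natural_coding:
  assumes "w \<in> natural_coding"
  shows "reduced_word A \<theta> w"
  unfolding reduced_word_def
proof
  assume "\<exists>a\<in>A. sublist [a, \<theta> a] w"
  then obtain a where a: "a \<in> A" and "[a, \<theta> a] \<in> natural_coding"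
    using assms factorial_natural_coding unfolding factorial_set_def by blast
  then obtain z where z: "z \<in> letter_interval a" "\<tau> z \<in> letter_interval (\<theta> a)"
    using cyl_Cons[OF a] cyl_single[OF theta_closed[OF a]] by (auto simp: natural_coding_eq)
  obtain x \<delta> where x: "\<sigma>1 z = (x, \<delta>)" by fastforce
  then have "(x, \<delta>) \<in> letter_interval (\<theta> a)" "(x, 1 - \<delta>) \<in> letter_interval (\<theta> a)"
    using z sigma1_letter[OF a z(1)] by (simp_all add: \<tau>_def flip_component_def)
  then have "\<delta> = 1 - \<delta>" by (rule letter_interval_component[OF theta_closed[OF a]])
  then show False by presburger
qed

text \<open>
  Conjugation by the component flip reverses orbits, since it exchanges \<open>\<tau>\<close> with its inverse.
\<close>

lemma inverse_cyl:
  assumes "w \<in> lists A" "z \<in> cyl w"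
  shows "flip_component ((\<tau> ^^ length w) z) \<in> cyl (inverse_word \<theta> w) \<and>
    (\<tau> ^^ length w) (flip_component ((\<tau> ^^ length w) z)) = flip_component z"
  using assms
proof (induction w arbitrary: z rule: list.induct)
  case Nil
  then show ?case using flip_closed by (simp add: inverse_word_def cyl_def)
next
  case (Cons a w)
  define y where "y = flip_component ((\<tau> ^^ length w) (\<tau> z))"
  from Cons.prems(1) have a: "a \<in> A" and w: "w \<in> lists A" by simp_all
  have z: "z \<in> letter_interval a" "\<tau> z \<in> cyl w" using Cons.prems(2) by (simp_all add: cyl_Cons[OF a])
  \<comment> \<open>The orbit of \<open>y\<close> retraces that of \<open>\<tau> z\<close> and ends
    at the flip of \<open>\<tau> z\<close>, which is \<open>\<sigma>1 z\<close>; its next letter is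
    therefore \<open>\<theta> a\<close>.\<close>
  have y: "y \<in> cyl (inverse_word \<theta> w)" "(\<tau> ^^ length w) y = \<sigma>1 z"
    using Cons.IH[OF w z(2)] flip_tau[OF a z(1)] by (simp_all add: y_def)
  have "y \<in> cyl (inverse_word \<theta> w @ [\<theta> a])"
    using y sigma1_letter[OF a z(1)] by (simp add: cyl_snoc inverse_word_def)
  moreover have "\<tau> ((\<tau> ^^ length w) y) = flip_component z"
    using y(2) sigma1_sigma1_letter[OF a z(1)] by (simp add: \<tau>_def)
  moreover have "flip_component ((\<tau> ^^ length (a # w)) z) = y"
    by (simp add: y_def funpow_swap1)
  ultimately show ?case by (simp add: inverse_word_def)
qed

lemma inverse_natural_coding:
  assumes "w \<in> natural_coding"
  shows "inverse_word \<theta> w \<in> natural_coding"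
proof -
  obtain z where "w \<in> lists A" "z \<in> cyl w" using assms by (auto simp: natural_coding_eq)
  then have "cyl (inverse_word \<theta> w) \<noteq> {}" using inverse_cyl by blast
  moreover have "inverse_word \<theta> w \<in> lists A"
    using \<open>w \<in> lists A\<close> theta_closed by (auto simp: inverse_word_def)
  ultimately show ?thesis by (simp add: natural_coding_eq)
qed

section \<open>Extension graphs\<close>

lemma tree_graph_section:
  assumes cd: "c < d" and s: "s = 1 \<or> s = -1"
    and sub: "\<And>x. x \<in> {c<..<d} \<Longrightarrow> (x, \<delta>) \<in> I_hat \<and> (s * x + \<alpha>, \<gamma>) \<in> I_hat"
    and no_conn: "\<And>x. x \<in> {c<..<d} \<Longrightarrow> (x, 1 - \<delta>) \<in> division_points \<Longrightarrow>
      (s * x + \<alpha>, \<gamma>) \<notin> division_points"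
  shows "tree_graph
    ({a \<in> A. \<exists>x\<in>{c<..<d}. (x, 1 - \<delta>) \<in> letter_interval (\<theta> a)} <+>
     {b \<in> A. \<exists>x\<in>{c<..<d}. (s * x + \<alpha>, \<gamma>) \<in> letter_interval b})
    {{Inl a, Inr b} | a b. a \<in> A \<and> b \<in> A \<and>
      (\<exists>x\<in>{c<..<d}. (x, 1 - \<delta>) \<in> letter_interval (\<theta> a) \<and> (s * x + \<alpha>, \<gamma>) \<in> letter_interval b)}"
    (is "tree_graph (?F <+> ?G) ?E")
proof -
  \<comment> \<open>\<open>P\<close> is the subdivision by preceding letters, cut at flipped
    division points; \<open>Q\<close> is the one by following letters, cut at pullbacks of division
    points.\<close>
  define P where "P a = {x \<in> {c<..<d}. (x, 1 - \<delta>) \<in> letter_interval (\<theta> a)}" for a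
  define Q where "Q b = {x \<in> {c<..<d}. (s * x + \<alpha>, \<gamma>) \<in> letter_interval b}" for b
  have "tree_graph (?F <+> ?G) {{Inl a, Inr b} | a b. a \<in> ?F \<and> b \<in> ?G \<and> P a \<inter> Q b \<noteq> {}}"
  proof (rule overlap_tree_graph[OF cd])
    show "P a \<noteq> {} \<and> (\<exists>u v. P a = {u<..<v})" if "a \<in> ?F" for a
      using that letter_preimage_interval[of "\<theta> a" 1 c d 0 "1 - \<delta>"] theta_closed[of a]
      by (auto simp: P_def)
    show "Q b \<noteq> {} \<and> (\<exists>u v. Q b = {u<..<v})" if "b \<in> ?G" for b
      using that letter_preimage_interval[of b s c d \<alpha> \<gamma>] s by (auto simp: Q_def)
    show "P a \<inter> P a' = {}" if "a \<in> ?F" "a' \<in> ?F" "a \<noteq> a'" for a a'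
    proof -
      have "\<theta> a \<noteq> \<theta> a'" using that theta_involution by (metis (no_types, lifting) mem_Collect_eq)
      then show ?thesis
        using that theta_closed letter_interval_disjoint[of "\<theta> a" "\<theta> a'"] unfolding P_def by blast
    qed
    show "Q b \<inter> Q b' = {}" if "b \<in> ?G" "b' \<in> ?G" "b \<noteq> b'" for b b'
      using that letter_interval_disjoint[of b b'] unfolding Q_def by blast
    show "(\<Union>a\<in>?F. P a) \<union> (\<Union>b\<in>?G. Q b) = {c<..<d}"
    proof (intro equalityI subsetI)
      fix x assume x: "x \<in> {c<..<d}"
      show "x \<in> (\<Union>a\<in>?F. P a) \<union> (\<Union>b\<in>?G. Q b)"
      \<comment> \<open>A cut point of the first subdivision is, by \<open>no_conn\<close>, not a
        cut point of the second, so some \<open>Q b\<close> contains it.\<close>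
      proof (cases "(x, 1 - \<delta>) \<in> division_points")
        case True
        then obtain b where "b \<in> A" "(s * x + \<alpha>, \<gamma>) \<in> letter_interval b"
          using no_conn[OF x] sub[OF x] letter_interval_exists by blast
        then show ?thesis using x unfolding Q_def by blast
      next
        case False
        have "(x, 1 - \<delta>) \<in> I_hat" using sub[OF x] by (auto simp: I_hat_def)
        then obtain b where "b \<in> A" "(x, 1 - \<delta>) \<in> letter_interval b"
          using False letter_interval_exists by blast
        \<comment> \<open>The flipped point lies in the interval of \<open>b\<close>, so the
          preceding letter is \<open>\<theta> b\<close>.\<close>
        then have "\<theta> b \<in> A" "(x, 1 - \<delta>) \<in> letter_interval (\<theta> (\<theta> b))"
          by (auto simp: theta_closed theta_involution)
        then show ?thesis using x unfolding P_def by blast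
      qed
    qed (auto simp: P_def Q_def)
  qed
  also have "{{Inl a, Inr b} | a b. a \<in> ?F \<and> b \<in> ?G \<and> P a \<inter> Q b \<noteq> {}} = ?E"
  proof -
    have "a \<in> ?F \<and> b \<in> ?G \<and> P a \<inter> Q b \<noteq> {} \<longleftrightarrow> a \<in> A \<and> b \<in> A \<and> (\<exists>x\<in>{c<..<d}.
      (x, 1 - \<delta>) \<in> letter_interval (\<theta> a) \<and> (s * x + \<alpha>, \<gamma>) \<in> letter_interval b)" for a b
      unfolding P_def Q_def by blast
    then show ?thesis by simp
  qed
  finally show ?thesis .
qed

text \<open>A common cut point of the two subdivisions would be a singularity of the inverse of
  \<open>T\<close> that \<open>length w\<close> steps take to a singularity of \<open>T\<close>,
  hence a connection.\<close>

lemma tree_graph_cyl: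
  assumes no_conn: "\<And>x y n. \<not> connection x y n"
    and w: "w \<in> natural_coding" "w \<noteq> []"
  shows "tree_graph (ext_verts A natural_coding w) (ext_edges A natural_coding w)"
proof -
  have wA: "w \<in> lists A" and ne: "cyl w \<noteq> {}" using w by (auto simp: natural_coding_eq)
  obtain c d \<delta> s \<alpha> \<gamma> where cyl: "cyl w = {c<..<d} \<times> {\<delta>}" and s: "s = 1 \<or> s = -1"
    and \<tau>: "\<And>x. x \<in> {c<..<d} \<Longrightarrow> (\<tau> ^^ length w) (x, \<delta>) = (s * x + \<alpha>, \<gamma>)"
    using cyl_affine[OF wA w(2)] by metis
  have cd: "c < d" using ne cyl by (cases "c < d") auto
  have mem: "(x, \<delta>) \<in> cyl w" if "x \<in> {c<..<d}" for x using that cyl by simp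
  \<comment> \<open>With \<open>R\<close> relating a point to its image, this single transfer to the
    real coordinate rewrites left, right and two-sided extensions alike.\<close>
  have bex: "(\<exists>z\<in>cyl w. R z ((\<tau> ^^ length w) z)) \<longleftrightarrow> (\<exists>x\<in>{c<..<d}. R (x, \<delta>) (s * x + \<alpha>, \<gamma>))" for R
  proof -
    have "(\<exists>z\<in>cyl w. R z ((\<tau> ^^ length w) z)) \<longleftrightarrow>
        (\<exists>x\<in>{c<..<d}. R (x, \<delta>) ((\<tau> ^^ length w) (x, \<delta>)))"
      unfolding cyl by blast
    also have "\<dots> \<longleftrightarrow> (\<exists>x\<in>{c<..<d}. R (x, \<delta>) (s * x + \<alpha>, \<gamma>))"
      using \<tau> by (intro bex_cong) auto
    finally show ?thesis .
  qed
  have flip: "flip_component (x, \<delta>) = (x, 1 - \<delta>)" for x by (simp add: flip_component_def)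
  have "left_ext A natural_coding w = {a \<in> A. \<exists>x\<in>{c<..<d}. (x, 1 - \<delta>) \<in> letter_interval (\<theta> a)}"
    unfolding left_ext_eq[OF wA] using bex[of "\<lambda>z _. flip_component z \<in> _"] by (simp add: flip)
  moreover have "right_ext A natural_coding w =
      {b \<in> A. \<exists>x\<in>{c<..<d}. (s * x + \<alpha>, \<gamma>) \<in> letter_interval b}"
    unfolding right_ext_eq[OF wA] using bex[of "\<lambda>_ z. z \<in> _"] by simp
  moreover have "bi_ext A natural_coding w = {(a, b) \<in> A \<times> A. \<exists>x\<in>{c<..<d}.
      (x, 1 - \<delta>) \<in> letter_interval (\<theta> a) \<and> (s * x + \<alpha>, \<gamma>) \<in> letter_interval b}"
    unfolding bi_ext_eq[OF wA] using bex[of "\<lambda>z z'. flip_component z \<in> _ \<and> z' \<in> _"] by (simp add: flip)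
  moreover have "tree_graph
    ({a \<in> A. \<exists>x\<in>{c<..<d}. (x, 1 - \<delta>) \<in> letter_interval (\<theta> a)} <+>
     {b \<in> A. \<exists>x\<in>{c<..<d}. (s * x + \<alpha>, \<gamma>) \<in> letter_interval b})
    {{Inl a, Inr b} | a b. a \<in> A \<and> b \<in> A \<and>
      (\<exists>x\<in>{c<..<d}. (x, 1 - \<delta>) \<in> letter_interval (\<theta> a) \<and> (s * x + \<alpha>, \<gamma>) \<in> letter_interval b)}"
  proof (rule tree_graph_section[OF cd s])
    fix x assume x: "x \<in> {c<..<d}"
    show I: "(x, \<delta>) \<in> I_hat \<and> (s * x + \<alpha>, \<gamma>) \<in> I_hat"
      using mem[OF x] cyl_subset funpow_tau_in_I_hat[OF wA mem[OF x]] \<tau>[OF x] by auto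
    assume "(x, 1 - \<delta>) \<in> division_points"
    then have "flip_component (flip_component (x, \<delta>)) \<in> flip_component ` division_points"
      unfolding flip by blast
    then have "(x, \<delta>) \<in> flip_component ` division_points" using I flip_flip by simp
    moreover have "T_pow (length w) (x, \<delta>) = Some (s * x + \<alpha>, \<gamma>)"
      using T_pow_cyl[OF wA mem[OF x], of "length w"] \<tau>[OF x] by simp
    ultimately show "(s * x + \<alpha>, \<gamma>) \<notin> division_points"
      using no_conn[of "(x, \<delta>)" "(s * x + \<alpha>, \<gamma>)" "length w"] by (simp add: connection_def)
  qed
  ultimately show ?thesis unfolding ext_verts_def ext_edges_def by simp
qed

text \<open>Each component is a section with the identity as its map, that is \<open>s = 1\<close>
  and \<open>\<alpha> = 0\<close>; a common cut point would be a connection with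
  \<open>n = 0\<close>.\<close>

lemma two_trees_Nil:
  assumes no_conn: "\<And>x y n. \<not> connection x y n"
  shows "disjoint_union_of_two_trees (ext_verts A natural_coding []) (ext_edges A natural_coding [])"
proof -
  define F where "F \<delta> = {a \<in> A. \<exists>x\<in>{lo<..<hi}. (x, 1 - \<delta>) \<in> letter_interval (\<theta> a)}" for \<delta>
  define G where "G \<delta> = {b \<in> A. \<exists>x\<in>{lo<..<hi}. (x, \<delta>) \<in> letter_interval b}" for \<delta>
  define D where "D \<delta> a b \<longleftrightarrow>
    (\<exists>x\<in>{lo<..<hi}. (x, 1 - \<delta>) \<in> letter_interval (\<theta> a) \<and> (x, \<delta>) \<in> letter_interval b)" for \<delta> a b
  define E :: "nat \<Rightarrow> ('a + 'a) set set"
    where "E \<delta> = {{Inl a, Inr b} | a b. a \<in> A \<and> b \<in> A \<and> D \<delta> a b}" for \<delta>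
  have tree: "tree_graph (F \<delta> <+> G \<delta>) (E \<delta>)" if \<delta>: "\<delta> \<in> {0, 1}" for \<delta>
  proof -
    have "(x, \<delta>) \<notin> division_points" if "x \<in> {lo<..<hi}" "(x, 1 - \<delta>) \<in> division_points" for x
    proof -
      have "(x, \<delta>) \<in> flip_component ` division_points"
        using that(2) \<delta> by (intro image_eqI[of _ _ "(x, 1 - \<delta>)"]) (auto simp: flip_component_def)
      then show ?thesis using no_conn[of "(x, \<delta>)" "(x, \<delta>)" 0] by (simp add: connection_def)
    qed
    then have "tree_graph
      ({a \<in> A. \<exists>x\<in>{lo<..<hi}. (x, 1 - \<delta>) \<in> letter_interval (\<theta> a)} <+>
       {b \<in> A. \<exists>x\<in>{lo<..<hi}. (1 * x + 0, \<delta>) \<in> letter_interval b})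
      {{Inl a, Inr b} | a b. a \<in> A \<and> b \<in> A \<and>
        (\<exists>x\<in>{lo<..<hi}. (x, 1 - \<delta>) \<in> letter_interval (\<theta> a) \<and> (1 * x + 0, \<delta>) \<in> letter_interval b)}"
      using \<delta> interval_nonempty by (intro tree_graph_section) (auto simp: I_hat_def)
    then show ?thesis by (simp add: F_def G_def E_def D_def)
  qed
  have bex: "(\<exists>z\<in>I_hat. R z) \<longleftrightarrow> (\<exists>x\<in>{lo<..<hi}. R (x, 0)) \<or> (\<exists>x\<in>{lo<..<hi}. R (x, 1))"
    for R :: "real \<times> nat \<Rightarrow> bool"
    unfolding I_hat_def by blast
  have left: "left_ext A natural_coding [] = F 0 \<union> F 1"
    by (auto simp: left_ext_eq cyl_Nil bex F_def flip_component_def)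
  have right: "right_ext A natural_coding [] = G 0 \<union> G 1"
    by (auto simp: right_ext_eq cyl_Nil bex G_def)
  have "bi_ext A natural_coding [] = {(a, b) \<in> A \<times> A. D 0 a b \<or> D 1 a b}"
    by (auto simp: bi_ext_eq cyl_Nil bex D_def flip_component_def)
  then have edges: "ext_edges A natural_coding [] = E 0 \<union> E 1"
    unfolding ext_edges_def E_def by auto
  \<comment> \<open>Membership in \<open>F 0\<close> or \<open>F 1\<close> places the interval of
    \<open>\<theta> a\<close> in component 1 or 0 respectively, and it has only one
    component.\<close>
  have "a \<notin> F 1" if "a \<in> F 0" for a
    using that letter_interval_component[of "\<theta> a" _ 1 _ 0] theta_closed[of a] by (auto simp: F_def)
  moreover have "b \<notin> G 1" if "b \<in> G 0" for b
    using that letter_interval_component[of b _ 0 _ 1] by (auto simp: G_def)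
  ultimately have "(F 0 <+> G 0) \<inter> (F 1 <+> G 1) = {}" by auto
  moreover have "ext_verts A natural_coding [] = (F 0 <+> G 0) \<union> (F 1 <+> G 1)"
    unfolding ext_verts_def left right by auto
  ultimately show ?thesis
    unfolding disjoint_union_of_two_trees_def edges using tree[of 0] tree[of 1]
    by (metis insertI1 insertI2)
qed

text \<open>Some point of the cylinder avoids two countable sets: \<open>orbit_set\<close>, which
  would stop its forward orbit, and the flipped division points, which have no preceding letter. Its
  two neighbouring letters extend \<open>w\<close>.\<close>

lemma biextendable_natural_coding: "biextendable A natural_coding"
  unfolding biextendable_def
proof (intro conjI ballI factorial_natural_coding)
  fix w assume "w \<in> natural_coding"
  then have w: "w \<in> lists A" and "cyl w \<noteq> {}" by (auto simp: natural_coding_eq)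
  define N where "N = orbit_set \<union> flip_component ` division_points"
  have "countable N"
    by (simp add: N_def countable_orbit_set countable_finite finite_division_points)
  then have "\<not> cyl w \<subseteq> N" using uncountable_cyl[OF w \<open>cyl w \<noteq> {}\<close>] countable_subset by blast
  then obtain z where z: "z \<in> cyl w" "z \<notin> orbit_set" "z \<notin> flip_component ` division_points"
    unfolding N_def by blast
  then have zI: "z \<in> I_hat" using cyl_subset by blast
  have "flip_component z \<notin> division_points" using z(3) flip_flip[OF zI] by (metis imageI)
  then obtain a where "a \<in> A" "flip_component z \<in> letter_interval a"
    using letter_interval_exists[OF flip_closed[OF zI]] by blast
  then have "\<theta> a \<in> A" "flip_component z \<in> letter_interval (\<theta> (\<theta> a))"
    by (simp_all add: theta_closed theta_involution)
  moreover obtain v where "infinite_coding z v" using infinite_coding_exists[OF zI z(2)] .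
  then have "v (length w) \<in> A" "(\<tau> ^^ length w) z \<in> letter_interval (v (length w))"
    by (rule infinite_coding_letter)+
  ultimately have "(\<theta> a, v (length w)) \<in> bi_ext A natural_coding w"
    using z(1) unfolding bi_ext_eq[OF w] by blast
  then show "bi_ext A natural_coding w \<noteq> {}" by blast
qed

lemma specular_natural_coding:
  assumes "\<And>x y n. \<not> connection x y n"
  shows "specular_set A \<theta> natural_coding"
  unfolding specular_set_def tree_set_char_two_def
  by (intro conjI ballI impI biextendable_natural_coding reduced_natural_coding
      inverse_natural_coding tree_graph_cyl[OF assms] two_trees_Nil[OF assms])

end

theorem theorem5p9:
  fixes A :: "'a set" and \<theta> :: "'a \<Rightarrow> 'a"
    and lo hi :: real and l m :: nat
    and \<pi> :: "nat \<Rightarrow> 'a" and len :: "'a \<Rightarrow> real"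
    and \<sigma>1 :: "real \<times> nat \<Rightarrow> real \<times> nat"
  assumes "involutive_alphabet A \<theta>"
    and "linear_involution A \<theta> lo hi l m \<pi> len \<sigma>1"
    and "\<not> (\<exists>x y n. linear_involution.connection lo hi l m \<pi> len \<sigma>1 x y n)"
  shows "specular_set A \<theta> (linear_involution.natural_coding A lo hi l m \<pi> len \<sigma>1)"
proof -
  interpret linear_involution A \<theta> lo hi l m \<pi> len \<sigma>1 by (rule assms(2))
  have "\<not> connection x y n" for x y n using assms(3) by blast
  then show ?thesis by (rule specular_natural_coding)
qed

end
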